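(* Let $(X,\|\cdot\|)$ be a Banach space that is uniformly nonsquare, with $\delta\in(0,1)$ witnessing this property, i.e. $$\min\left\{\frac{\|x-y\|}{2},\frac{\|x+y\|}{2}\right\}\le(1-\delta)\cdot\max\{\|x\|,\|y\|\}\quad\text{for all }x,y\in X.$$ Define $\lambda:=1-\delta$. Assume that $\xi\in(0,1)$ is so small and that $p'\in[2,\infty)$ is so large that $$\frac{1-\xi}{1+2\sqrt{2\xi}}\geq\frac12\sqrt{2\lambda^2+2}\qquad\text{and}\qquad\frac1{2^{1/p'}}\geq1-\xi.$$ Take $p$ with $1=\frac1p+\frac1{p'}$. Then for any $q\in(1,p)$, the space $X$ has Rademacher type $q$ with constant $$C_q=3\cdot\frac{2^{1/q}}{2^{(1/q)-(1/p)}-1}.$$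
   Context: A Banach space $X$ has Rademacher type $q\in[1,2]$ with constant $C_q$ if for all finite sequences $(x_1,\ldots,x_n)$ in $X$ $$\mathbb E\left(\left\|\sum_{i=1}^n\varepsilon_ix_i\right\|^q\right)^{1/q}\le C_q\cdot\left(\sum_{i=1}^n\|x_i\|^q\right)^{1/q},$$ where the $\varepsilon_i$ are independent random variables with values $\pm1$, each with probability $1/2$, i.e. $\mathbb E\left(\left\|\sum_{i=1}^n\varepsilon_ix_i\right\|^q\right)=\frac1{2^n}\sum_{\varepsilon_1,\ldots,\varepsilon_n\in\{-1,1\}}\left\|\sum_{i=1}^n\varepsilon_ix_i\right\|^q$. *)

theory Defs
  imports "HOL-Analysis.Analysis"
begin

text \<open>
  The Banach space is the whole of a type of class \<open>banach\<close>, passed to the predicates below as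
  \<open>TYPE('a)\<close>. The class records the real structure only; complex Banach spaces are covered
  by restriction of scalars.
\<close>

definition uniformly_nonsquare :: "'a::banach itself \<Rightarrow> real \<Rightarrow> bool" where
  "uniformly_nonsquare X \<delta> \<longleftrightarrow> 0 < \<delta> \<and> \<delta> < 1 \<and>
     (\<forall>x y :: 'a. min (norm (x - y) / 2) (norm (x + y) / 2) \<le> (1 - \<delta>) * max (norm x) (norm y))"

text \<open>
  The expectation over \<open>n\<close> independent uniform signs, written as the average
  over the \<open>2 ^ n\<close> sign patterns.
\<close>

definition sign_expectation :: "nat \<Rightarrow> ((nat \<Rightarrow> real) \<Rightarrow> real) \<Rightarrow> real" where
  "sign_expectation n f = (1 / 2 ^ n) * (\<Sum>\<epsilon> \<in> {..<n} \<rightarrow>\<^sub>E {-1, 1}. f \<epsilon>)"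

definition rademacher_type :: "'a::banach itself \<Rightarrow> real \<Rightarrow> real \<Rightarrow> bool" where
  "rademacher_type X q C \<longleftrightarrow> 1 \<le> q \<and> q \<le> 2 \<and>
     (\<forall>n. \<forall>x :: nat \<Rightarrow> 'a.
        sign_expectation n (\<lambda>\<epsilon>. norm (\<Sum>i<n. \<epsilon> i *\<^sub>R x i) powr q) powr (1 / q)
          \<le> C * (\<Sum>i<n. norm (x i) powr q) powr (1 / q))"

end

theory Submission
  imports Defs
begin

text \<open>
  Two-point information is amplified to Rademacher type through second moments.

  In a uniformly nonsquare space one of \<open>norm (x + y)\<close>, \<open>norm (x - y)\<close> falls short of its trivial
  bound. For vectors of equal norm this makes \<open>(norm (x + y))\<^sup>2 + (norm (x - y))\<^sup>2\<close> a definite factor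
  smaller than \<open>4 * ((norm x)\<^sup>2 + (norm y)\<^sup>2)\<close>; for vectors of very different norms the triangle
  inequality already gives such a gain. The condition on \<open>\<xi>\<close> balances the two cases, and the gain is
  the factor \<open>(1 - \<xi>)\<^sup>2\<close> (\<open>uniformly_nonsquare_two_point\<close>). As \<open>2 * (1 - \<xi>) \<le> 2 powr (1 / p)\<close>, the
  factor \<open>4 * (1 - \<xi>)\<^sup>2\<close> may be replaced by \<open>2 powr (2 / p)\<close>.

  The symmetry of the signs carries the two-point inequality over to sums of \<open>2 ^ k\<close> vectors by
  repeated halving (\<open>rademacher_second_moment_le\<close>), so that \<open>m = 2 ^ k\<close> vectors of norm at most \<open>M\<close>
  have a Rademacher sum of quadratic mean at most \<open>m powr (1 / p) * M\<close>. This is what type \<open>p\<close> would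
  give for vectors of equal norm. Arbitrary vectors are grouped into dyadic blocks of comparable
  norm; the bounds of the blocks then form a geometric series of ratio \<open>2 powr (1 / p - 1 / q)\<close>, which
  converges precisely because \<open>q < p\<close> and whose sum is the source of the constant
  (\<open>rademacher_norm_le_of_two_point\<close>). Finally, \<open>p \<le> 2\<close> makes the \<open>q\<close>-th mean at most the
  quadratic mean.
\<close>

section \<open>Averages over signs\<close>

lemma finite_signs: "finite ({..<n :: nat} \<rightarrow>\<^sub>E {-1, 1 :: real})"
  by (simp add: finite_PiE)

lemma card_signs: "card ({..<n :: nat} \<rightarrow>\<^sub>E {-1, 1 :: real}) = 2 ^ n"
  by (simp add: card_PiE numeral_2_eq_2)

lemma sign_expectation_mono:
  assumes "\<And>\<epsilon>. \<epsilon> \<in> {..<n} \<rightarrow>\<^sub>E {-1, 1} \<Longrightarrow> f \<epsilon> \<le> g \<epsilon>"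
  shows "sign_expectation n f \<le> sign_expectation n g"
  using assms unfolding sign_expectation_def by (intro mult_left_mono sum_mono) auto

lemma sign_expectation_cong:
  assumes "\<And>\<epsilon>. \<epsilon> \<in> {..<n} \<rightarrow>\<^sub>E {-1, 1} \<Longrightarrow> f \<epsilon> = g \<epsilon>"
  shows "sign_expectation n f = sign_expectation n g"
  using assms unfolding sign_expectation_def by (simp cong: sum.cong)

lemma sign_expectation_add:
  "sign_expectation n (\<lambda>\<epsilon>. f \<epsilon> + g \<epsilon>) = sign_expectation n f + sign_expectation n g"
  by (simp add: sign_expectation_def sum.distrib distrib_left add_divide_distrib)

lemma sign_expectation_cmult:
  "sign_expectation n (\<lambda>\<epsilon>. c * f \<epsilon>) = c * sign_expectation n f"
  by (simp add: sign_expectation_def flip: sum_distrib_left)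

lemma sign_expectation_const: "sign_expectation n (\<lambda>\<epsilon>. c) = c"
  by (simp add: sign_expectation_def card_signs)

lemma sign_expectation_nonneg:
  assumes "\<And>\<epsilon>. 0 \<le> f \<epsilon>"
  shows "0 \<le> sign_expectation n f"
  using assms by (simp add: sign_expectation_def sum_nonneg)

text \<open>Independent signs are symmetric: flipping those indexed by \<open>K\<close> permutes the sign patterns.\<close>

lemma sign_expectation_flip:
  assumes "K \<subseteq> {..<n}"
  shows "sign_expectation n (\<lambda>\<epsilon>. f (\<lambda>i. if i \<in> K then - \<epsilon> i else \<epsilon> i)) = sign_expectation n f"
proof -
  define flip where "flip = (\<lambda>(\<epsilon> :: nat \<Rightarrow> real) i. if i \<in> K then - \<epsilon> i else \<epsilon> i)"
  have invol: "flip (flip \<epsilon>) = \<epsilon>" for \<epsilon>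
    by (auto simp: flip_def)
  have signs: "flip \<epsilon> \<in> {..<n} \<rightarrow>\<^sub>E {-1, 1}" if "\<epsilon> \<in> {..<n} \<rightarrow>\<^sub>E {-1, 1}" for \<epsilon>
  proof (rule PiE_I)
    show "flip \<epsilon> i \<in> {-1, 1}" if "i \<in> {..<n}" for i
      using PiE_mem[OF \<open>\<epsilon> \<in> _\<close> that] by (auto simp: flip_def)
    show "flip \<epsilon> i = undefined" if "i \<notin> {..<n}" for i
      using PiE_arb[OF \<open>\<epsilon> \<in> _\<close> that] assms that by (auto simp: flip_def)
  qed
  have "(\<Sum>\<epsilon> \<in> {..<n} \<rightarrow>\<^sub>E {-1, 1}. f (flip \<epsilon>)) = (\<Sum>\<epsilon> \<in> {..<n} \<rightarrow>\<^sub>E {-1, 1}. f \<epsilon>)"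
    by (rule sum.reindex_bij_witness[where i = flip and j = flip]) (use invol signs in auto)
  then show ?thesis
    by (simp add: sign_expectation_def flip_def)
qed

text \<open>
  Let \<open>M\<close> be the mean of the squares. The tangent at \<open>1\<close> of the concave function
  \<open>u \<mapsto> u powr (q / 2)\<close> lies above it, and evaluated at \<open>u = f\<^sup>2 / M\<close> the tangent has average \<open>1\<close>.
\<close>

lemma sign_expectation_powr_mean_le:
  fixes q :: real
  assumes q: "0 < q" "q \<le> 2" and f: "\<And>\<epsilon>. 0 \<le> f \<epsilon>"
  shows "sign_expectation n (\<lambda>\<epsilon>. f \<epsilon> powr q) powr (1 / q) \<le> sqrt (sign_expectation n (\<lambda>\<epsilon>. (f \<epsilon>)\<^sup>2))"
proof -
  define M where "M = sign_expectation n (\<lambda>\<epsilon>. (f \<epsilon>)\<^sup>2)"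
  have "0 \<le> M"
    unfolding M_def by (intro sign_expectation_nonneg) auto
  have tangent: "u powr (q / 2) \<le> q / 2 * u + (1 - q / 2)" if "0 \<le> u" for u :: real
    using Youngs_inequality_0[of "q / 2" "1 - q / 2" u 1] that q by (cases "u = 0") auto
  have "sign_expectation n (\<lambda>\<epsilon>. f \<epsilon> powr q) \<le> M powr (q / 2)"
  proof (cases "M = 0")
    case True
    then have "(\<Sum>\<epsilon> \<in> {..<n} \<rightarrow>\<^sub>E {-1, 1}. (f \<epsilon>)\<^sup>2) = 0"
      by (simp add: M_def sign_expectation_def)
    then have "f \<epsilon> = 0" if "\<epsilon> \<in> {..<n} \<rightarrow>\<^sub>E {-1, 1}" for \<epsilon>
      using that finite_signs by (subst (asm) sum_nonneg_eq_0_iff) auto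
    then show ?thesis
      using True by (simp add: sign_expectation_def)
  next
    case False
    with \<open>0 \<le> M\<close> have "0 < M" by simp
    have "f \<epsilon> powr q \<le> M powr (q / 2) * (q / 2 / M * (f \<epsilon>)\<^sup>2 + (1 - q / 2))" for \<epsilon>
    proof -
      have "(f \<epsilon>)\<^sup>2 powr (q / 2) = f \<epsilon> powr q"
        using f[of \<epsilon>] powr_powr[of "f \<epsilon>" 2 "q / 2"] by (cases "f \<epsilon> = 0") (auto simp: powr_numeral)
      then have "f \<epsilon> powr q = M powr (q / 2) * ((f \<epsilon>)\<^sup>2 / M) powr (q / 2)"
        using \<open>0 < M\<close> by (simp add: powr_divide)
      also have "\<dots> \<le> M powr (q / 2) * (q / 2 * ((f \<epsilon>)\<^sup>2 / M) + (1 - q / 2))"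
        using \<open>0 < M\<close> by (intro mult_left_mono tangent) auto
      finally show ?thesis by simp
    qed
    then have "sign_expectation n (\<lambda>\<epsilon>. f \<epsilon> powr q)
        \<le> sign_expectation n (\<lambda>\<epsilon>. M powr (q / 2) * (q / 2 / M * (f \<epsilon>)\<^sup>2 + (1 - q / 2)))"
      by (intro sign_expectation_mono)
    also have "\<dots> = M powr (q / 2) * (q / 2 / M * M + (1 - q / 2))"
      unfolding sign_expectation_cmult sign_expectation_add sign_expectation_const M_def ..
    also have "\<dots> = M powr (q / 2)"
      using \<open>0 < M\<close> by simp
    finally show ?thesis .
  qed
  then have "sign_expectation n (\<lambda>\<epsilon>. f \<epsilon> powr q) powr (1 / q) \<le> (M powr (q / 2)) powr (1 / q)"
    using q by (intro powr_mono2 sign_expectation_nonneg) auto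
  also have "\<dots> = sqrt M"
    using q \<open>0 \<le> M\<close> by (simp add: powr_powr powr_half_sqrt)
  finally show ?thesis
    unfolding M_def .
qed


section \<open>Quadratic means of partial Rademacher sums\<close>

definition rademacher_norm :: "nat \<Rightarrow> (nat \<Rightarrow> 'a::real_normed_vector) \<Rightarrow> nat set \<Rightarrow> real" where
  "rademacher_norm n x I = sqrt (sign_expectation n (\<lambda>\<epsilon>. (norm (\<Sum>i\<in>I. \<epsilon> i *\<^sub>R x i))\<^sup>2))"

text \<open>This form makes Minkowski's inequality applicable.\<close>

lemma rademacher_norm_conv_L2_set:
  "rademacher_norm n x I =
     L2_set (\<lambda>\<epsilon>. norm (\<Sum>i\<in>I. \<epsilon> i *\<^sub>R x i)) ({..<n} \<rightarrow>\<^sub>E {-1, 1}) / sqrt (2 ^ n)"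
  by (simp add: rademacher_norm_def sign_expectation_def L2_set_def real_sqrt_divide)

lemma rademacher_norm_Un_le:
  assumes "finite I" "finite J" "I \<inter> J = {}"
  shows "rademacher_norm n x (I \<union> J) \<le> rademacher_norm n x I + rademacher_norm n x J"
proof -
  let ?S = "\<lambda>I \<epsilon>. norm (\<Sum>i\<in>I. \<epsilon> i *\<^sub>R x i)" and ?signs = "{..<n} \<rightarrow>\<^sub>E {-1, 1 :: real}"
  have "L2_set (?S (I \<union> J)) ?signs \<le> L2_set (\<lambda>\<epsilon>. ?S I \<epsilon> + ?S J \<epsilon>) ?signs"
    using assms by (intro L2_set_mono) (auto simp: sum.union_disjoint norm_triangle_ineq)
  also have "\<dots> \<le> L2_set (?S I) ?signs + L2_set (?S J) ?signs"
    by (rule L2_set_triangle_ineq)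
  finally show ?thesis
    by (simp add: rademacher_norm_conv_L2_set divide_right_mono flip: add_divide_distrib)
qed

lemma rademacher_norm_UN_le:
  fixes B :: "nat \<Rightarrow> nat set"
  assumes "\<And>j. finite (B j)" "disjoint_family B"
  shows "rademacher_norm n x (\<Union>j<N. B j) \<le> (\<Sum>j<N. rademacher_norm n x (B j))"
proof (induction N)
  case 0
  show ?case by (simp add: rademacher_norm_def sign_expectation_const)
next
  case (Suc N)
  have "B j \<inter> B N = {}" if "j < N" for j
    using that by (intro disjoint_family_onD[OF assms(2)]) auto
  then have disj: "(\<Union>j<N. B j) \<inter> B N = {}"
    by blast
  have "rademacher_norm n x (\<Union>j<Suc N. B j) = rademacher_norm n x ((\<Union>j<N. B j) \<union> B N)"
    by (simp add: lessThan_Suc Un_commute)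
  also have "\<dots> \<le> rademacher_norm n x (\<Union>j<N. B j) + rademacher_norm n x (B N)"
    using assms(1) disj by (intro rademacher_norm_Un_le) auto
  finally show ?case
    using Suc.IH by simp
qed

text \<open>
  A quadratic inequality for two vectors tensorises. If \<open>U\<close> and \<open>V\<close> are the Rademacher sums over two
  halves of \<open>I\<close>, flipping the signs of the second half shows that \<open>U + V\<close> and \<open>U - V\<close> have the same
  second moment, which is therefore at most \<open>A\<close> times the sum of those of \<open>U\<close> and \<open>V\<close>. Each halving
  costs one factor \<open>A\<close>.
\<close>

lemma rademacher_second_moment_le:
  fixes x :: "nat \<Rightarrow> 'a::real_normed_vector"
  assumes two_point: "\<And>u v :: 'a. (norm (u + v))\<^sup>2 + (norm (u - v))\<^sup>2 \<le> 2 * A * ((norm u)\<^sup>2 + (norm v)\<^sup>2)"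
    and "0 \<le> A" and "I \<subseteq> {..<n}" and "card I \<le> 2 ^ k"
  shows "sign_expectation n (\<lambda>\<epsilon>. (norm (\<Sum>i\<in>I. \<epsilon> i *\<^sub>R x i))\<^sup>2) \<le> A ^ k * (\<Sum>i\<in>I. (norm (x i))\<^sup>2)"
  using assms(3,4)
proof (induction k arbitrary: I)
  case 0
  then have "finite I" using finite_subset by blast
  show ?case
  proof (cases "I = {}")
    case True
    then show ?thesis by (simp add: sign_expectation_const)
  next
    case False
    with 0 \<open>finite I\<close> have "card I = 1"
      by (metis One_nat_def card_gt_0_iff le_antisym power_0 Suc_leI)
    then obtain i where I: "I = {i}" by (auto simp: card_1_singleton_iff)
    have "sign_expectation n (\<lambda>\<epsilon>. (norm (\<Sum>i\<in>I. \<epsilon> i *\<^sub>R x i))\<^sup>2) = sign_expectation n (\<lambda>\<epsilon>. (norm (x i))\<^sup>2)"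
    proof (rule sign_expectation_cong)
      fix \<epsilon> :: "nat \<Rightarrow> real" assume "\<epsilon> \<in> {..<n} \<rightarrow>\<^sub>E {-1, 1}"
      then have "\<epsilon> i \<in> {-1, 1}"
        using 0 I by (auto dest: PiE_mem[where x = i])
      then show "(norm (\<Sum>i\<in>I. \<epsilon> i *\<^sub>R x i))\<^sup>2 = (norm (x i))\<^sup>2"
        by (auto simp: I)
    qed
    then show ?thesis by (simp add: I sign_expectation_const)
  qed
next
  case (Suc k)
  then have "finite I" using finite_subset by blast
  obtain J where J: "J \<subseteq> I" "card J = min (card I) (2 ^ k)"
    using obtain_subset_with_card_n[OF min.cobounded1[of "card I" "2 ^ k"]] by metis
  define K where "K = I - J"
  have sub: "J \<subseteq> {..<n}" "K \<subseteq> {..<n}" and I: "I = J \<union> K" "J \<inter> K = {}"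
    using J Suc.prems by (auto simp: K_def)
  then have fin: "finite J" "finite K"
    using \<open>finite I\<close> by auto
  have cards: "card J \<le> 2 ^ k" "card K \<le> 2 ^ k"
    using J Suc.prems fin by (auto simp: K_def card_Diff_subset)
  let ?U = "\<lambda>\<epsilon> :: nat \<Rightarrow> real. \<Sum>i\<in>J. \<epsilon> i *\<^sub>R x i" and ?V = "\<lambda>\<epsilon> :: nat \<Rightarrow> real. \<Sum>i\<in>K. \<epsilon> i *\<^sub>R x i"
  let ?E = "sign_expectation n"
  have plus: "(\<Sum>i\<in>I. \<epsilon> i *\<^sub>R x i) = ?U \<epsilon> + ?V \<epsilon>" for \<epsilon>
    using I fin by (simp add: sum.union_disjoint)
  have minus: "(\<Sum>i\<in>I. (if i \<in> K then - \<epsilon> i else \<epsilon> i) *\<^sub>R x i) = ?U \<epsilon> - ?V \<epsilon>" for \<epsilon>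
  proof -
    have "(\<Sum>i\<in>J. (if i \<in> K then - \<epsilon> i else \<epsilon> i) *\<^sub>R x i) = ?U \<epsilon>"
      using I by (intro sum.cong) auto
    moreover have "(\<Sum>i\<in>K. (if i \<in> K then - \<epsilon> i else \<epsilon> i) *\<^sub>R x i) = - ?V \<epsilon>"
      by (simp add: sum_negf)
    ultimately show ?thesis
      using I fin by (simp add: sum.union_disjoint)
  qed
  have "?E (\<lambda>\<epsilon>. (norm (?U \<epsilon> + ?V \<epsilon>))\<^sup>2) = ?E (\<lambda>\<epsilon>. (norm (?U \<epsilon> - ?V \<epsilon>))\<^sup>2)"
    using sign_expectation_flip[OF sub(2), of "\<lambda>\<epsilon>. (norm (\<Sum>i\<in>I. \<epsilon> i *\<^sub>R x i))\<^sup>2"]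
    unfolding minus unfolding plus by (rule sym)
  then have "2 * ?E (\<lambda>\<epsilon>. (norm (?U \<epsilon> + ?V \<epsilon>))\<^sup>2)
      = ?E (\<lambda>\<epsilon>. (norm (?U \<epsilon> + ?V \<epsilon>))\<^sup>2 + (norm (?U \<epsilon> - ?V \<epsilon>))\<^sup>2)"
    unfolding sign_expectation_add by linarith
  also have "\<dots> \<le> ?E (\<lambda>\<epsilon>. 2 * A * ((norm (?U \<epsilon>))\<^sup>2 + (norm (?V \<epsilon>))\<^sup>2))"
    by (intro sign_expectation_mono two_point)
  also have "\<dots> = 2 * (A * (?E (\<lambda>\<epsilon>. (norm (?U \<epsilon>))\<^sup>2) + ?E (\<lambda>\<epsilon>. (norm (?V \<epsilon>))\<^sup>2)))"
    by (simp only: sign_expectation_cmult sign_expectation_add mult.assoc)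
  finally have "?E (\<lambda>\<epsilon>. (norm (?U \<epsilon> + ?V \<epsilon>))\<^sup>2)
      \<le> A * (?E (\<lambda>\<epsilon>. (norm (?U \<epsilon>))\<^sup>2) + ?E (\<lambda>\<epsilon>. (norm (?V \<epsilon>))\<^sup>2))"
    by linarith
  also have "\<dots> \<le> A * (A ^ k * (\<Sum>i\<in>J. (norm (x i))\<^sup>2) + A ^ k * (\<Sum>i\<in>K. (norm (x i))\<^sup>2))"
    using \<open>0 \<le> A\<close> Suc.IH[OF sub(1) cards(1)] Suc.IH[OF sub(2) cards(2)]
    by (intro mult_left_mono add_mono)
  also have "\<dots> = A ^ Suc k * (\<Sum>i\<in>I. (norm (x i))\<^sup>2)"
    using I fin by (simp add: sum.union_disjoint algebra_simps)
  finally show ?case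
    unfolding plus .
qed

text \<open>
  With \<open>A = w\<^sup>2 / 2\<close>, the \<open>k\<close> halvings cost \<open>(w\<^sup>2 / 2) ^ k\<close>, and the number of terms restores the
  factor \<open>2 ^ k\<close>. For \<open>w = 2 powr (1 / p)\<close> the bound reads \<open>(2 ^ k) powr (1 / p) * M\<close>.
\<close>

lemma rademacher_norm_bounded_le:
  fixes x :: "nat \<Rightarrow> 'a::real_normed_vector"
  assumes two_point: "\<And>u v :: 'a. (norm (u + v))\<^sup>2 + (norm (u - v))\<^sup>2 \<le> w\<^sup>2 * ((norm u)\<^sup>2 + (norm v)\<^sup>2)"
    and "0 \<le> w" and "I \<subseteq> {..<n}" and "card I \<le> 2 ^ k"
    and M: "0 \<le> M" "\<And>i. i \<in> I \<Longrightarrow> norm (x i) \<le> M"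
  shows "rademacher_norm n x I \<le> w ^ k * M"
proof -
  have "sign_expectation n (\<lambda>\<epsilon>. (norm (\<Sum>i\<in>I. \<epsilon> i *\<^sub>R x i))\<^sup>2) \<le> (w\<^sup>2 / 2) ^ k * (\<Sum>i\<in>I. (norm (x i))\<^sup>2)"
    using assms by (intro rademacher_second_moment_le) auto
  also have "\<dots> \<le> (w\<^sup>2 / 2) ^ k * (2 ^ k * M\<^sup>2)"
  proof (intro mult_left_mono)
    have "(\<Sum>i\<in>I. (norm (x i))\<^sup>2) \<le> real (card I) * M\<^sup>2"
      using M by (intro sum_bounded_above power_mono) auto
    also have "\<dots> \<le> 2 ^ k * M\<^sup>2"
      using of_nat_mono[OF \<open>card I \<le> 2 ^ k\<close>, where ?'a = real] by (intro mult_right_mono) auto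
    finally show "(\<Sum>i\<in>I. (norm (x i))\<^sup>2) \<le> 2 ^ k * M\<^sup>2" .
  qed auto
  also have "\<dots> = (w ^ k * M)\<^sup>2"
    by (simp add: power_divide power_mult_distrib flip: power_mult) (simp add: mult.commute)
  finally show ?thesis
    unfolding rademacher_norm_def using \<open>0 \<le> w\<close> M(1) by (intro real_le_lsqrt) auto
qed


section \<open>From vectors of comparable norms to Rademacher type\<close>

lemma ex_dyadic_level:
  fixes t :: real
  assumes "0 < t" "t \<le> 1"
  shows "\<exists>j. (1 / 2) ^ Suc j < t \<and> t \<le> (1 / 2) ^ j"
proof -
  obtain j where "(1 / 2) ^ j < t"
    using real_arch_pow_inv[of t "1 / 2"] assms by auto
  then have ex: "\<exists>j. (1 / 2) ^ Suc j < t"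
    using \<open>0 < t\<close> by (intro exI[of _ j]) simp
  define m where "m = (LEAST j. (1 / 2) ^ Suc j < t)"
  have "(1 / 2) ^ Suc m < t"
    unfolding m_def using ex by (rule LeastI_ex)
  moreover have "t \<le> (1 / 2) ^ m"
  proof (cases m)
    case 0
    then show ?thesis using assms by simp
  next
    case (Suc l)
    then have "\<not> (1 / 2) ^ Suc l < t"
      using not_less_Least[of l "\<lambda>j. (1 / 2) ^ Suc j < t"] by (simp add: m_def)
    then show ?thesis using Suc by simp
  qed
  ultimately show ?thesis by blast
qed

text \<open>
  Scale to \<open>s = 1\<close>, so that the \<open>norm (x i) powr q\<close> add up to \<open>1\<close>, and group the indices by the
  dyadic level \<open>j\<close> of these summands. Level \<open>j\<close> has at most \<open>2 ^ (j + 1)\<close> members, all of norm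
  at most \<open>2 powr (- j / q)\<close>, and so contributes at most \<open>2 powr ((j + 1) / p - j / q)\<close>. Since
  \<open>q < p\<close>, these bounds form a convergent geometric series.
\<close>

lemma rademacher_norm_le_of_two_point:
  fixes x :: "nat \<Rightarrow> 'a::real_normed_vector" and p q :: real
  assumes two_point: "\<And>u v :: 'a. (norm (u + v))\<^sup>2 + (norm (u - v))\<^sup>2
      \<le> (2 powr (1 / p))\<^sup>2 * ((norm u)\<^sup>2 + (norm v)\<^sup>2)"
    and q: "0 < q" "q < p"
  shows "rademacher_norm n x {..<n}
    \<le> 2 powr (1 / q) / (2 powr (1 / q - 1 / p) - 1) * (\<Sum>i<n. norm (x i) powr q) powr (1 / q)"
proof -
  define S where "S = (\<Sum>i<n. norm (x i) powr q)"
  define s where "s = S powr (1 / q)"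
  define w where "w = 2 powr (1 / p)"
  define v where "v = 2 powr (- 1 / q)"
  have "0 < w" "0 < v"
    by (auto simp: w_def v_def)
  have wv: "w * v = 2 powr (1 / p - 1 / q)" "w * v < 1"
    using q powr_less_mono[of "1 / p - 1 / q" 0 2]
    by (auto simp: w_def v_def frac_less2 simp flip: powr_add)
  have term_le: "norm (x i) powr q \<le> S" if "i < n" for i
    unfolding S_def using that by (intro member_le_sum) auto
  have level_ex: "\<exists>j. S * (1 / 2) ^ Suc j < norm (x i) powr q \<and> norm (x i) powr q \<le> S * (1 / 2) ^ j"
    if "i < n" "x i \<noteq> 0" for i
  proof -
    have "0 < norm (x i) powr q" using that by simp
    moreover from this have "0 < S" using term_le[OF that(1)] by linarith
    ultimately show ?thesis
      using ex_dyadic_level[of "norm (x i) powr q / S"] term_le[OF that(1)]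
      by (simp add: pos_less_divide_eq pos_divide_le_eq mult.commute)
  qed
  define level where "level i = (SOME j. S * (1 / 2) ^ Suc j < norm (x i) powr q
      \<and> norm (x i) powr q \<le> S * (1 / 2) ^ j)" for i
  have level: "S * (1 / 2) ^ Suc (level i) < norm (x i) powr q"
      "norm (x i) powr q \<le> S * (1 / 2) ^ level i" if "i < n" "x i \<noteq> 0" for i
    using someI_ex[OF level_ex[OF that]] unfolding level_def by auto
  define B where "B j = {i. i < n \<and> x i \<noteq> 0 \<and> level i = j}" for j
  have finB: "finite (B j)" for j by (simp add: B_def)
  have block: "rademacher_norm n x (B j) \<le> s * w * (w * v) ^ j" for j
  proof -
    have "rademacher_norm n x (B j) \<le> w ^ Suc j * (s * v ^ j)"
    proof (rule rademacher_norm_bounded_le)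
      show "(norm (u + v))\<^sup>2 + (norm (u - v))\<^sup>2 \<le> w\<^sup>2 * ((norm u)\<^sup>2 + (norm v)\<^sup>2)" for u v :: 'a
        unfolding w_def by (rule two_point)
      show "0 \<le> w" "0 \<le> s * v ^ j" "B j \<subseteq> {..<n}"
        using \<open>0 < w\<close> \<open>0 < v\<close> by (auto simp: s_def B_def)
      show "norm (x i) \<le> s * v ^ j" if "i \<in> B j" for i
      proof -
        have "0 \<le> S" by (simp add: S_def sum_nonneg)
        have "norm (x i) = (norm (x i) powr q) powr (1 / q)"
          using q by (simp add: powr_powr)
        also have "\<dots> \<le> (S * (1 / 2) ^ j) powr (1 / q)"
          using level[of i] that q by (intro powr_mono2) (auto simp: B_def)
        also have "\<dots> = s * v ^ j"
        proof -
          have "((1 / 2 :: real) ^ j) powr (1 / q) = v ^ j"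
            by (simp add: v_def powr_powr powr_minus powr_realpow[symmetric] powr_divide field_simps)
          then show ?thesis
            using \<open>0 \<le> S\<close> by (simp add: s_def powr_mult)
        qed
        finally show ?thesis .
      qed
      \<comment> \<open>Each member of the block contributes more than \<open>S / 2 ^ Suc j\<close> to the total \<open>S\<close>.\<close>
      show "card (B j) \<le> 2 ^ Suc j"
      proof (cases "B j = {}")
        case False
        then obtain i where i: "i < n" "x i \<noteq> 0" by (auto simp: B_def)
        then have "0 < norm (x i) powr q" by simp
        then have "0 < S" using term_le[OF i(1)] by linarith
        have "card (B j) * (S * (1 / 2) ^ Suc j) \<le> (\<Sum>i\<in>B j. norm (x i) powr q)"
          by (intro sum_bounded_below) (use level in \<open>force simp: B_def\<close>)
        also have "\<dots> \<le> S"
          unfolding S_def by (intro sum_mono2) (auto simp: B_def)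
        finally have "real (card (B j)) \<le> 2 ^ Suc j"
          using \<open>0 < S\<close> by (simp add: field_simps)
        then show ?thesis
          by (metis of_nat_le_iff of_nat_numeral of_nat_power)
      qed simp
    qed
    then show ?thesis
      by (simp add: power_mult_distrib mult_ac)
  qed
  define N where "N = Suc (Max (insert 0 (level ` {..<n})))"
  have level_less: "level i < N" if "i < n" for i
    unfolding N_def using that by (auto simp: less_Suc_eq_le intro: Max_ge)
  \<comment> \<open>Zero vectors lie in no block, but do not affect the sum.\<close>
  have "rademacher_norm n x {..<n} = rademacher_norm n x (\<Union>j<N. B j)"
  proof -
    have "(\<Sum>i<n. \<epsilon> i *\<^sub>R x i) = (\<Sum>i\<in>(\<Union>j<N. B j). \<epsilon> i *\<^sub>R x i)" for \<epsilon> :: "nat \<Rightarrow> real"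
      using level_less by (intro sum.mono_neutral_right) (auto simp: B_def)
    then show ?thesis by (simp add: rademacher_norm_def)
  qed
  also have "\<dots> \<le> (\<Sum>j<N. rademacher_norm n x (B j))"
    using finB by (intro rademacher_norm_UN_le) (auto simp: disjoint_family_on_def B_def)
  also have "\<dots> \<le> (\<Sum>j<N. s * w * (w * v) ^ j)"
    by (intro sum_mono block)
  also have "\<dots> = s * w * (\<Sum>j<N. (w * v) ^ j)"
    by (simp add: sum_distrib_left)
  also have "\<dots> \<le> s * w * (1 / (1 - w * v))"
  proof (intro mult_left_mono)
    show "(\<Sum>j<N. (w * v) ^ j) \<le> 1 / (1 - w * v)"
      using wv(2) \<open>0 < w\<close> \<open>0 < v\<close>
      by (subst sum_gp_strict) (auto intro!: divide_right_mono)
  qed (use \<open>0 < w\<close> in \<open>simp add: s_def\<close>)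
  also have "w * (1 / (1 - w * v)) = 2 powr (1 / q) / (2 powr (1 / q - 1 / p) - 1)"
  proof -
    have two_powr: "2 powr (1 / q) = 1 / v" "2 powr (1 / q - 1 / p) = 1 / (w * v)"
      by (simp_all add: w_def v_def powr_minus powr_diff field_simps)
    show ?thesis
      using \<open>0 < w\<close> \<open>0 < v\<close> wv(2) unfolding two_powr
      by (simp add: divide_simps mult.commute)
  qed
  then have "s * w * (1 / (1 - w * v)) = 2 powr (1 / q) / (2 powr (1 / q - 1 / p) - 1) * s"
    by (metis mult.assoc mult.commute)
  finally show ?thesis
    by (simp add: s_def S_def)
qed


section \<open>Uniformly nonsquare spaces\<close>

text \<open>
  Here \<open>1\<close> and \<open>t\<close> are the norms of two vectors, scaled so that the larger norm is \<open>1\<close>, while \<open>a\<close>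
  and \<open>b\<close> are the norms of their sum and difference. The triangle inequality alone bounds the
  left-hand side by \<open>2 * (1 + t)\<^sup>2 = 4 * (1 + t\<^sup>2) - 2 * (1 - t)\<^sup>2\<close>, which suffices unless
  \<open>1 - t \<le> 2 * sqrt (2 * \<xi>)\<close>. In the remaining case nonsquareness bounds one of the two squares
  by \<open>4 * lam\<^sup>2\<close>, and the other one is at most \<open>4\<close>; as \<open>t\<close> is close to \<open>1\<close>, the hypothesis on
  \<open>\<xi>\<close> makes the right-hand side at least \<open>4 * lam\<^sup>2 + 4\<close>.
\<close>

lemma two_point_real_bound:
  fixes lam \<xi> t a b :: real
  assumes "0 < \<xi>" "\<xi> < 1"
    and \<xi>: "1 / 2 * sqrt (2 * lam\<^sup>2 + 2) \<le> (1 - \<xi>) / (1 + 2 * sqrt (2 * \<xi>))"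
    and t: "0 \<le> t" "t \<le> 1"
    and ab: "0 \<le> a" "a \<le> 1 + t" "0 \<le> b" "b \<le> 1 + t" "min a b \<le> 2 * lam"
  shows "a\<^sup>2 + b\<^sup>2 \<le> 4 * (1 - \<xi>)\<^sup>2 * (1 + t\<^sup>2)"
proof -
  define r where "r = 2 * sqrt (2 * \<xi>)"
  have "0 < r" and r2: "r\<^sup>2 = 8 * \<xi>"
    using \<open>0 < \<xi>\<close> by (auto simp: r_def power_mult_distrib)
  show ?thesis
  proof (cases "1 - t \<le> r")
    case False
    have "a\<^sup>2 + b\<^sup>2 \<le> (1 + t)\<^sup>2 + (1 + t)\<^sup>2"
      using ab by (intro add_mono power_mono) auto
    also have "\<dots> = 4 * (1 + t\<^sup>2) - 2 * (1 - t)\<^sup>2"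
      by (simp add: power2_eq_square algebra_simps)
    also have "\<dots> \<le> 4 * (1 + t\<^sup>2) - 2 * (8 * \<xi>)"
      using False \<open>0 < r\<close> power_mono[of r "1 - t" 2] r2 by auto
    also have "\<dots> \<le> 4 * (1 + t\<^sup>2) - 8 * \<xi> * (1 + t\<^sup>2)"
      using \<open>0 < \<xi>\<close> t power_mono[of t 1 2] mult_left_mono[of "t\<^sup>2" 1 \<xi>] by (simp add: algebra_simps)
    also have "\<dots> = 4 * (1 - 2 * \<xi>) * (1 + t\<^sup>2)"
      by (simp add: algebra_simps)
    also have "\<dots> \<le> 4 * (1 - \<xi>)\<^sup>2 * (1 + t\<^sup>2)"
      by (intro mult_right_mono) (auto simp: power2_eq_square algebra_simps)
    finally show ?thesis .
  next
    case True
    have "1 / 2 * sqrt (2 * lam\<^sup>2 + 2) * (1 + r) \<le> 1 - \<xi>"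
      using \<xi> \<open>0 < r\<close> unfolding r_def[symmetric] by (subst (asm) pos_le_divide_eq) auto
    then have "(1 / 2 * sqrt (2 * lam\<^sup>2 + 2) * (1 + r))\<^sup>2 \<le> (1 - \<xi>)\<^sup>2"
      using \<open>0 < r\<close> by (intro power_mono) auto
    then have lam: "(2 * lam\<^sup>2 + 2) * (1 + r)\<^sup>2 \<le> 4 * (1 - \<xi>)\<^sup>2"
      by (simp add: power_mult_distrib power_divide)
    \<comment> \<open>The denominator \<open>1 + r\<close> in the hypothesis on \<open>\<xi>\<close> absorbs the loss from \<open>t < 1\<close>.\<close>
    have "2 \<le> (1 + r)\<^sup>2 * (1 + t\<^sup>2)"
    proof -
      define d where "d = 1 - t"
      have "(1 + d)\<^sup>2 * (1 + t\<^sup>2) = 2 + d * (2 - d) + d ^ 4"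
        by (simp add: d_def power2_eq_square power4_eq_xxxx algebra_simps)
      moreover have "0 \<le> d * (2 - d)"
        using t by (simp add: d_def)
      ultimately have "2 \<le> (1 + d)\<^sup>2 * (1 + t\<^sup>2)" by simp
      also have "\<dots> \<le> (1 + r)\<^sup>2 * (1 + t\<^sup>2)"
        using True t by (intro mult_right_mono power_mono) (auto simp: d_def)
      finally show ?thesis .
    qed
    have "a\<^sup>2 + b\<^sup>2 \<le> (2 * lam)\<^sup>2 + 2\<^sup>2"
    proof (cases "a \<le> b")
      case True
      then show ?thesis using ab t by (intro add_mono power_mono) auto
    next
      case False
      then have "b\<^sup>2 + a\<^sup>2 \<le> (2 * lam)\<^sup>2 + 2\<^sup>2" using ab t by (intro add_mono power_mono) auto
      then show ?thesis by simp
    qed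
    also have "\<dots> = (2 * lam\<^sup>2 + 2) * 2"
      by (simp add: power_mult_distrib)
    also have "\<dots> \<le> (2 * lam\<^sup>2 + 2) * ((1 + r)\<^sup>2 * (1 + t\<^sup>2))"
      using \<open>2 \<le> (1 + r)\<^sup>2 * (1 + t\<^sup>2)\<close> by (intro mult_left_mono) auto
    also have "\<dots> \<le> 4 * (1 - \<xi>)\<^sup>2 * (1 + t\<^sup>2)"
      using mult_right_mono[OF lam, of "1 + t\<^sup>2"] by (simp add: mult.assoc)
    finally show ?thesis .
  qed
qed

lemma uniformly_nonsquare_two_point:
  fixes x y :: "'a::banach" and \<delta> \<xi> :: real
  assumes nonsquare: "uniformly_nonsquare TYPE('a) \<delta>"
    and \<xi>: "0 < \<xi>" "\<xi> < 1"
      "1 / 2 * sqrt (2 * (1 - \<delta>)\<^sup>2 + 2) \<le> (1 - \<xi>) / (1 + 2 * sqrt (2 * \<xi>))"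
  shows "(norm (x + y))\<^sup>2 + (norm (x - y))\<^sup>2 \<le> 4 * (1 - \<xi>)\<^sup>2 * ((norm x)\<^sup>2 + (norm y)\<^sup>2)"
proof -
  have ordered: "(norm (x + y))\<^sup>2 + (norm (x - y))\<^sup>2 \<le> 4 * (1 - \<xi>)\<^sup>2 * ((norm x)\<^sup>2 + (norm y)\<^sup>2)"
    if le: "norm y \<le> norm x" for x y :: 'a
  proof (cases "x = 0")
    case True
    then show ?thesis using le by simp
  next
    case False
    define m where "m = norm x"
    have "0 < m" using False by (simp add: m_def)
    have "(norm (x + y) / m)\<^sup>2 + (norm (x - y) / m)\<^sup>2 \<le> 4 * (1 - \<xi>)\<^sup>2 * (1 + (norm y / m)\<^sup>2)"
    proof (rule two_point_real_bound[OF \<xi>])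
      have "min (norm (x - y) / 2) (norm (x + y) / 2) \<le> (1 - \<delta>) * max (norm x) (norm y)"
        using nonsquare by (simp add: uniformly_nonsquare_def)
      then have "min (norm (x - y) / 2) (norm (x + y) / 2) \<le> (1 - \<delta>) * m"
        using le by (simp add: m_def max_def)
      then show "min (norm (x + y) / m) (norm (x - y) / m) \<le> 2 * (1 - \<delta>)"
        using \<open>0 < m\<close> unfolding min_le_iff_disj
        by (subst (1 2) pos_divide_le_eq) (auto simp: algebra_simps)
      show "norm (x + y) / m \<le> 1 + norm y / m"
        using \<open>0 < m\<close> norm_triangle_ineq[of x y] by (simp add: field_simps m_def)
      show "norm (x - y) / m \<le> 1 + norm y / m"
        using \<open>0 < m\<close> norm_triangle_ineq4[of x y] by (simp add: field_simps m_def)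
    qed (use \<open>0 < m\<close> le in \<open>auto simp: m_def\<close>)
    then have "m\<^sup>2 * ((norm (x + y) / m)\<^sup>2 + (norm (x - y) / m)\<^sup>2)
        \<le> m\<^sup>2 * (4 * (1 - \<xi>)\<^sup>2 * (1 + (norm y / m)\<^sup>2))"
      by (intro mult_left_mono) auto
    moreover have "m\<^sup>2 * ((norm (x + y) / m)\<^sup>2 + (norm (x - y) / m)\<^sup>2) = (norm (x + y))\<^sup>2 + (norm (x - y))\<^sup>2"
      using \<open>0 < m\<close> by (simp add: power_divide distrib_left)
    moreover have "m\<^sup>2 * (4 * (1 - \<xi>)\<^sup>2 * (1 + (norm y / m)\<^sup>2)) = 4 * (1 - \<xi>)\<^sup>2 * (m\<^sup>2 + (norm y)\<^sup>2)"
      using \<open>0 < m\<close> by (simp add: power_divide distrib_left mult.left_commute)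
    ultimately show ?thesis
      by (simp only: m_def)
  qed
  show ?thesis
    using ordered[of y x] ordered[of x y]
    by (cases "norm y \<le> norm x") (auto simp: add.commute norm_minus_commute)
qed

theorem theorem6:
  fixes \<delta> lam \<xi> p p' q :: real
  assumes "uniformly_nonsquare TYPE('a::banach) \<delta>"
    and "lam = 1 - \<delta>"
    and "0 < \<xi>" and "\<xi> < 1"
    and "2 \<le> p'"
    and "(1 - \<xi>) / (1 + 2 * sqrt (2 * \<xi>)) \<ge> 1 / 2 * sqrt (2 * lam\<^sup>2 + 2)"
    and "1 / 2 powr (1 / p') \<ge> 1 - \<xi>"
    and "1 = 1 / p + 1 / p'"
    and "1 < q" and "q < p"
  shows "rademacher_type TYPE('a) q (3 * (2 powr (1 / q) / (2 powr (1 / q - 1 / p) - 1)))"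
proof -
  have inv_p: "1 / p = 1 - 1 / p'"
    using assms(8) by simp
  have "1 / 2 \<le> 1 / p"
    using \<open>2 \<le> p'\<close> by (simp add: inv_p field_simps)
  have "0 < p" using \<open>1 < q\<close> \<open>q < p\<close> by simp
  with \<open>1 / 2 \<le> 1 / p\<close> have "q \<le> 2"
    using \<open>q < p\<close> by (simp add: field_simps)
  \<comment> \<open>Since \<open>1 / p = 1 - 1 / p'\<close>, this is the hypothesis on \<open>p'\<close> multiplied by \<open>2\<close>.\<close>
  have xi_le: "2 * (1 - \<xi>) \<le> 2 powr (1 / p)"
    using assms(7) unfolding inv_p by (simp add: powr_diff)
  have two_point: "(norm (u + v))\<^sup>2 + (norm (u - v))\<^sup>2 \<le> (2 powr (1 / p))\<^sup>2 * ((norm u)\<^sup>2 + (norm v)\<^sup>2)"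
    for u v :: 'a
  proof -
    have "(norm (u + v))\<^sup>2 + (norm (u - v))\<^sup>2 \<le> (2 * (1 - \<xi>))\<^sup>2 * ((norm u)\<^sup>2 + (norm v)\<^sup>2)"
      using uniformly_nonsquare_two_point[OF assms(1), of \<xi> u v] assms(2-4,6)
      unfolding power_mult_distrib[of 2] by simp
    also have "\<dots> \<le> (2 powr (1 / p))\<^sup>2 * ((norm u)\<^sup>2 + (norm v)\<^sup>2)"
      using xi_le \<open>\<xi> < 1\<close> by (intro mult_right_mono power_mono) auto
    finally show ?thesis .
  qed
  define C where "C = 2 powr (1 / q) / (2 powr (1 / q - 1 / p) - 1)"
  have "1 / p < 1 / q"
    using \<open>1 < q\<close> \<open>q < p\<close> by (intro divide_strict_left_mono) auto
  then have "1 < 2 powr (1 / q - 1 / p)"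
    using powr_less_mono[of 0 "1 / q - 1 / p" 2] by simp
  then have "0 \<le> C"
    by (simp add: C_def)
  have "sign_expectation n (\<lambda>\<epsilon>. norm (\<Sum>i<n. \<epsilon> i *\<^sub>R x i) powr q) powr (1 / q)
      \<le> 3 * C * (\<Sum>i<n. norm (x i) powr q) powr (1 / q)" for n and x :: "nat \<Rightarrow> 'a"
  proof -
    have "sign_expectation n (\<lambda>\<epsilon>. norm (\<Sum>i<n. \<epsilon> i *\<^sub>R x i) powr q) powr (1 / q)
        \<le> rademacher_norm n x {..<n}"
      unfolding rademacher_norm_def
      using \<open>1 < q\<close> \<open>q \<le> 2\<close> by (intro sign_expectation_powr_mean_le) auto
    also have "\<dots> \<le> C * (\<Sum>i<n. norm (x i) powr q) powr (1 / q)"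
      unfolding C_def using \<open>1 < q\<close> \<open>q < p\<close> by (intro rademacher_norm_le_of_two_point two_point) auto
    also have "\<dots> \<le> 3 * C * (\<Sum>i<n. norm (x i) powr q) powr (1 / q)"
      using \<open>0 \<le> C\<close> by (intro mult_right_mono) auto
    finally show ?thesis .
  qed
  then show ?thesis
    using \<open>1 < q\<close> \<open>q \<le> 2\<close> by (simp add: rademacher_type_def C_def)
qed

end
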